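(* Let $1\le m<n$ be integers and let $g$ be a differentiable function on $(a,b)$. (A) If $\mathbb{E}|X_{1:n}|<\infty$ and $\mathbb{E}(X_{1:n}\mid X_{1:m})=g(X_{1:m})$ almost surely, then (A.1) $\lim_{x\to a^+}g(x)=a$; (A.2) $g'$ is a decreasing function with $\lim_{x\to a^+}g'(x)=1$ and $\lim_{x\to b^-}g'(x)=0$; (A.3) $F(x)=1-\sqrt[n-m]{g'(x)}$ for $x\in(a,b)$. (B) If $\mathbb{E}|X_{n:n}|<\infty$ and $\mathbb{E}(X_{n:n}\mid X_{m:m})=g(X_{m:m})$ almost surely, then (B.1) $\lim_{x\to b^-}g(x)=b$; (B.2) $g'$ is an increasing function with $\lim_{x\to a^+}g'(x)=0$ and $\lim_{x\to b^-}g'(x)=1$; (B.3) $F(x)=\sqrt[n-m]{g'(x)}$ for $x\in(a,b)$.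
   Context: $X_1,X_2,\ldots$ are independent identically distributed real random variables with cumulative distribution function $F$, absolutely continuous with respect to Lebesgue measure, and the density $f=F'$ is strictly positive on $(a,b):=\{x\in\mathbb{R}:0<F(x)<1\}$, where $-\infty\le a<b\le\infty$. $X_{i:m}$ denotes the $i$-th smallest among $X_1,\ldots,X_m$ (so $X_{1:m}$ is the minimum and $X_{m:m}$ the maximum of $X_1,\ldots,X_m$). *)

theory Defs
  imports "HOL-Probability.Probability"
begin

text \<open>The sequence is indexed from 1 and \<open>X 0\<close> is unused. The value is only meaningful for
  \<open>1 \<le> i \<le> m\<close>; ties are counted with multiplicity.\<close>

definition order_statistic :: "(nat \<Rightarrow> 'w \<Rightarrow> real) \<Rightarrow> nat \<Rightarrow> nat \<Rightarrow> 'w \<Rightarrow> real" where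
  "order_statistic X i m \<omega> = sort (map (\<lambda>j. X j \<omega>) [1..<Suc m]) ! (i - 1)"

text \<open>A version of the conditional expectation of \<open>Y\<close> given the real random variable \<open>Z\<close>, i.e. given
  the \<open>\<sigma>\<close>-algebra on \<open>space M\<close> generated by \<open>Z\<close>.\<close>

definition cond_exp_given :: "'w measure \<Rightarrow> ('w \<Rightarrow> real) \<Rightarrow> ('w \<Rightarrow> real) \<Rightarrow> 'w \<Rightarrow> real" where
  "cond_exp_given M Y Z = real_cond_exp M (vimage_algebra (space M) Z borel) Y"

text \<open>Independent real random variables \<open>X 1, X 2, \<dots>\<close> with common distribution function \<open>F\<close> and
  common Lebesgue density \<open>f\<close> (so that \<open>F' = f\<close> almost everywhere), where
  \<open>f\<close> is positive on \<open>(a, b) = {x. 0 < F x < 1}\<close>. The end points are extended reals, and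
  \<open>einterval a b\<close> is the set of real numbers strictly between them.\<close>

definition iid_positive_density ::
    "'w measure \<Rightarrow> (nat \<Rightarrow> 'w \<Rightarrow> real) \<Rightarrow> (real \<Rightarrow> real) \<Rightarrow> (real \<Rightarrow> real) \<Rightarrow> ereal \<Rightarrow> ereal \<Rightarrow> bool" where
  "iid_positive_density M X F f a b \<longleftrightarrow>
     prob_space M \<and>
     prob_space.indep_vars M (\<lambda>_. borel) X {1..} \<and>
     (\<forall>i\<ge>1. cdf (distr M borel (X i)) = F) \<and>
     (\<forall>i\<ge>1. distributed M lborel (X i) (\<lambda>x. ennreal (f x))) \<and>
     (\<forall>x. 0 \<le> f x) \<and>
     a < b \<and>
     {x. 0 < F x \<and> F x < 1} = einterval a b \<and>
     (\<forall>x \<in> einterval a b. 0 < f x)"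

end

theory Submission
  imports Defs
begin

text \<open>The maximum of the sample splits as \<open>max Z W\<close>, where \<open>Z\<close> is the maximum of the first \<open>m\<close>
  observations and \<open>W\<close> that of the remaining \<open>n - m\<close>. These are independent, so the conditional
  expectation is \<open>h Z\<close> with \<open>h x = E (max x W)\<close>, whose derivative is \<open>P (W \<le> x) = F x ^ (n - m)\<close>.
  Since \<open>Z\<close> charges every open subinterval of \<open>(a, b)\<close> and \<open>g\<close>, \<open>h\<close> are continuous there, \<open>g = h\<close> on
  \<open>(a, b)\<close>; and \<open>x \<le> h x \<le> b\<close> gives the boundary limit of \<open>g\<close>. The minimum is symmetric, with
  \<open>P (W > x) = (1 - F x) ^ (n - m)\<close>.\<close>

section \<open>Extreme order statistics as minima and maxima, and their splitting at
  \<open>m\<close>\<close>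

lemma order_statistic_first:
  assumes "1 \<le> m"
  shows "order_statistic X 1 m \<omega> = (MIN j\<in>{1..m}. X j \<omega>)"
proof -
  let ?xs = "sort (map (\<lambda>j. X j \<omega>) [1..<Suc m])"
  have set: "set ?xs = (\<lambda>j. X j \<omega>) ` {1..m}"
    by (simp only: set_sort set_map set_upt atLeastLessThanSuc_atLeastAtMost)
  have len: "length ?xs = m"
    by simp
  have "Min (set ?xs) = ?xs ! 0"
  proof (rule Min_eqI)
    fix y assume "y \<in> set ?xs"
    then obtain i where "i < length ?xs" "y = ?xs ! i"
      by (metis in_set_conv_nth)
    then show "?xs ! 0 \<le> y"
      using sorted_nth_mono[of ?xs 0 i] by (simp del: upt_Suc)
  next
    show "?xs ! 0 \<in> set ?xs"
      using assms len by (intro nth_mem) simp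
  qed simp
  then show ?thesis
    by (simp add: order_statistic_def set atLeastLessThanSuc_atLeastAtMost del: upt_Suc)
qed

lemma order_statistic_last:
  assumes "1 \<le> m"
  shows "order_statistic X m m \<omega> = (MAX j\<in>{1..m}. X j \<omega>)"
proof -
  let ?xs = "sort (map (\<lambda>j. X j \<omega>) [1..<Suc m])"
  have set: "set ?xs = (\<lambda>j. X j \<omega>) ` {1..m}"
    by (simp only: set_sort set_map set_upt atLeastLessThanSuc_atLeastAtMost)
  have len: "length ?xs = m"
    by simp
  have "Max (set ?xs) = ?xs ! (m - 1)"
  proof (rule Max_eqI)
    fix y assume "y \<in> set ?xs"
    then obtain i where "i < length ?xs" "y = ?xs ! i"
      by (metis in_set_conv_nth)
    then show "y \<le> ?xs ! (m - 1)"
      using sorted_nth_mono[of ?xs i "m - 1"] len assms by (simp del: upt_Suc)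
  next
    show "?xs ! (m - 1) \<in> set ?xs"
      using assms len by (intro nth_mem) simp
  qed simp
  then show ?thesis
    by (simp add: order_statistic_def set atLeastLessThanSuc_atLeastAtMost del: upt_Suc)
qed

lemma atLeastAtMost_split:
  fixes m n :: nat
  assumes "m < n"
  shows "{1..n} = {1..m} \<union> {Suc m..n}"
  using assms by auto

text \<open>The index set splits into the first \<open>m\<close> observations and the other
  \<open>n - m\<close>. These two blocks are disjoint, which later makes the two minima
  independent.\<close>

lemma order_statistic_first_split:
  assumes "1 \<le> m" "m < n"
  shows "order_statistic X 1 n \<omega> = min (order_statistic X 1 m \<omega>) (MIN j\<in>{Suc m..n}. X j \<omega>)"
proof -
  have "1 \<le> n"
    using assms by simp
  then show ?thesis
    using assms
    by (simp add: order_statistic_first atLeastAtMost_split[OF assms(2)] image_Un Min_Un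
        del: One_nat_def)
qed

lemma order_statistic_last_split:
  assumes "1 \<le> m" "m < n"
  shows "order_statistic X n n \<omega> = max (order_statistic X m m \<omega>) (MAX j\<in>{Suc m..n}. X j \<omega>)"
proof -
  have "1 \<le> n"
    using assms by simp
  then show ?thesis
    using assms
    by (simp add: order_statistic_last atLeastAtMost_split[OF assms(2)] image_Un Max_Un
        del: One_nat_def)
qed

section \<open>Conditional expectation of a function of two independent variables\<close>

context prob_space
begin

text \<open>Independence makes the joint law of \<open>Z\<close> and \<open>W\<close> the product of
  their laws, so Fubini applies to \<open>\<phi>\<close>.\<close>

lemma indep_var_integrable_pair:
  fixes \<phi> :: "'b \<times> 'b \<Rightarrow> real"
  assumes ind: "indep_var S Z T W"
    and \<phi>: "\<phi> \<in> borel_measurable (S \<Otimes>\<^sub>M T)"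
    and int: "integrable M (\<lambda>\<omega>. \<phi> (Z \<omega>, W \<omega>))"
  shows "integrable (distr M S Z \<Otimes>\<^sub>M distr M T W) \<phi>"
    and "(\<integral>z. \<integral>w. \<phi> (z, w) \<partial>distr M T W \<partial>distr M S Z) = (\<integral>\<omega>. \<phi> (Z \<omega>, W \<omega>) \<partial>M)"
proof -
  have Z[measurable]: "Z \<in> measurable M S" and W[measurable]: "W \<in> measurable M T"
    and eq: "distr M S Z \<Otimes>\<^sub>M distr M T W = distr M (S \<Otimes>\<^sub>M T) (\<lambda>x. (Z x, W x))"
    using ind unfolding indep_var_distribution_eq by auto
  interpret DZ: prob_space "distr M S Z" by (rule prob_space_distr) fact
  interpret DW: prob_space "distr M T W" by (rule prob_space_distr) fact
  interpret P: pair_sigma_finite "distr M S Z" "distr M T W" ..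
  show I: "integrable (distr M S Z \<Otimes>\<^sub>M distr M T W) \<phi>"
    using int \<phi> by (simp add: eq integrable_distr_eq)
  have "(\<integral>z. \<integral>w. \<phi> (z, w) \<partial>distr M T W \<partial>distr M S Z)
      = (\<integral>x. \<phi> x \<partial>(distr M S Z \<Otimes>\<^sub>M distr M T W))"
    using P.integral_fst'[OF I] by simp
  also have "\<dots> = (\<integral>\<omega>. \<phi> (Z \<omega>, W \<omega>) \<partial>M)"
    using \<phi> by (simp add: eq integral_distr)
  finally show "(\<integral>z. \<integral>w. \<phi> (z, w) \<partial>distr M T W \<partial>distr M S Z) = (\<integral>\<omega>. \<phi> (Z \<omega>, W \<omega>) \<partial>M)" .
qed

text \<open>By Fubini almost every section is integrable, and a probability measure does not let an
  almost sure property hold nowhere. Used to find one truncation level of \<open>W\<close> with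
  finite expectation.\<close>

lemma indep_var_ex_integrable_section:
  fixes \<phi> :: "'b \<times> 'b \<Rightarrow> real"
  assumes ind: "indep_var S Z T W"
    and \<phi>: "\<phi> \<in> borel_measurable (S \<Otimes>\<^sub>M T)"
    and int: "integrable M (\<lambda>\<omega>. \<phi> (Z \<omega>, W \<omega>))"
  shows "\<exists>z. integrable M (\<lambda>\<omega>. \<phi> (z, W \<omega>))"
proof -
  have Z[measurable]: "Z \<in> measurable M S" and W[measurable]: "W \<in> measurable M T"
    using ind unfolding indep_var_distribution_eq by auto
  interpret DZ: prob_space "distr M S Z" by (rule prob_space_distr) fact
  interpret DW: prob_space "distr M T W" by (rule prob_space_distr) fact
  interpret P: pair_sigma_finite "distr M S Z" "distr M T W" ..
  have "AE z in distr M S Z. integrable (distr M T W) (\<lambda>w. \<phi> (z, w))"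
    using P.AE_integrable_fst'[OF indep_var_integrable_pair(1)[OF assms]] .
  \<comment> \<open>Membership in \<open>space S\<close> is carried along because the section at
    \<open>z\<close> is measurable only for such \<open>z\<close>.\<close>
  then have "AE z in distr M S Z. integrable (distr M T W) (\<lambda>w. \<phi> (z, w)) \<and> z \<in> space S"
    using AE_space[of "distr M S Z"] by eventually_elim auto
  then obtain z where z: "integrable (distr M T W) (\<lambda>w. \<phi> (z, w))" "z \<in> space S"
    using eventually_happens'[OF DZ.ae_filter_bot] by blast
  have "(\<lambda>w. \<phi> (z, w)) \<in> borel_measurable T"
    using \<phi> z(2) by measurable
  then show ?thesis
    using z(1) integrable_distr_eq[OF W] by blast
qed

lemma cond_exp_given_indep_var:
  fixes \<phi> :: "real \<times> real \<Rightarrow> real"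
  assumes ind: "indep_var borel Z borel W"
    and \<phi>[measurable]: "\<phi> \<in> borel_measurable (borel \<Otimes>\<^sub>M borel)"
    and int: "integrable M (\<lambda>\<omega>. \<phi> (Z \<omega>, W \<omega>))"
  shows "AE \<omega> in M. cond_exp_given M (\<lambda>\<omega>. \<phi> (Z \<omega>, W \<omega>)) Z \<omega> = (\<integral>\<omega>'. \<phi> (Z \<omega>, W \<omega>') \<partial>M)"
proof -
  have Z[measurable]: "Z \<in> borel_measurable M" and W[measurable]: "W \<in> borel_measurable M"
    using ind unfolding indep_var_distribution_eq by auto
  interpret DZ: prob_space "distr M borel Z" by (rule prob_space_distr) fact
  interpret DW: prob_space "distr M borel W" by (rule prob_space_distr) fact
  interpret P: pair_sigma_finite "distr M borel Z" "distr M borel W" ..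
  let ?V = "vimage_algebra (space M) Z borel"
  define h where "h z = (\<integral>w. \<phi> (z, w) \<partial>distr M borel W)" for z
  have h_eq: "h z = (\<integral>\<omega>'. \<phi> (z, W \<omega>') \<partial>M)" for z
    unfolding h_def by (rule integral_distr) measurable
  have sub: "subalgebra M ?V"
    unfolding subalgebra_def
    by (auto simp: sets_vimage_algebra2 intro: measurable_sets[OF Z])
  interpret finite_measure_subalgebra M ?V
    by standard (rule sub)
  have h_int: "integrable (distr M borel Z) h"
    unfolding h_def by (rule P.integrable_fst'[OF indep_var_integrable_pair(1)[OF assms]])
  then have h[measurable]: "h \<in> borel_measurable borel"
    by auto
  have "AE \<omega> in M. real_cond_exp M ?V (\<lambda>\<omega>. \<phi> (Z \<omega>, W \<omega>)) \<omega> = h (Z \<omega>)"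
  proof (rule real_cond_exp_charact)
    show "integrable M (\<lambda>\<omega>. h (Z \<omega>))"
      using h_int by (simp add: integrable_distr_eq)
    have "Z \<in> measurable ?V borel"
      by (rule measurable_vimage_algebra1) auto
    then show "(\<lambda>\<omega>. h (Z \<omega>)) \<in> borel_measurable ?V"
      by measurable
    fix A assume "A \<in> sets ?V"
    then obtain B where B[measurable]: "B \<in> sets borel" and A: "A = Z -` B \<inter> space M"
      by (auto simp: sets_vimage_algebra2)
    \<comment> \<open>Multiplying by an indicator keeps integrability, so the Fubini identity also
      applies to the integrand restricted to \<open>B\<close>.\<close>
    have *: "integrable M (\<lambda>\<omega>. indicator B (Z \<omega>) * \<phi> (Z \<omega>, W \<omega>))"
      by (rule Bochner_Integration.integrable_bound[OF int]) (auto split: split_indicator)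
    have "(\<integral>\<omega>\<in>A. \<phi> (Z \<omega>, W \<omega>) \<partial>M) = (\<integral>\<omega>. indicator B (Z \<omega>) * \<phi> (Z \<omega>, W \<omega>) \<partial>M)"
      unfolding set_lebesgue_integral_def A
      by (rule Bochner_Integration.integral_cong) (auto split: split_indicator)
    also have "\<dots> = (\<integral>z. \<integral>w. indicator B z * \<phi> (z, w) \<partial>distr M borel W \<partial>distr M borel Z)"
      using indep_var_integrable_pair(2)[OF ind, of "\<lambda>x. indicator B (fst x) * \<phi> x"] * by simp
    \<comment> \<open>The indicator depends on \<open>z\<close> alone and leaves the inner
      integral.\<close>
    also have "\<dots> = (\<integral>z. indicator B z * h z \<partial>distr M borel Z)"
      by (simp add: h_def)
    also have "\<dots> = (\<integral>\<omega>. indicator B (Z \<omega>) * h (Z \<omega>) \<partial>M)"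
      by (rule integral_distr) measurable
    also have "\<dots> = (\<integral>\<omega>\<in>A. h (Z \<omega>) \<partial>M)"
      unfolding set_lebesgue_integral_def A
      by (rule Bochner_Integration.integral_cong) (auto split: split_indicator)
    finally show "(\<integral>\<omega>\<in>A. \<phi> (Z \<omega>, W \<omega>) \<partial>M) = (\<integral>\<omega>\<in>A. h (Z \<omega>) \<partial>M)" .
  qed (rule int)
  then show ?thesis
    by (simp add: cond_exp_given_def h_eq)
qed

end

section \<open>Differentiating the expectation of a truncated variable\<close>

text \<open>The bounds are subgradient inequalities of a convex function: for either sign of
  \<open>y - x\<close> the difference quotient lies between \<open>G x\<close> and
  \<open>G y\<close>, and continuity of \<open>G\<close> at \<open>x\<close> closes the gap. No
  interchange of derivative and expectation is required.\<close>

lemma DERIV_sandwich: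
  fixes h G :: "real \<Rightarrow> real"
  assumes lower: "\<And>y. (y - x) * G x \<le> h y - h x"
    and upper: "\<And>y. h y - h x \<le> (y - x) * G y"
    and cont: "isCont G x"
  shows "(h has_real_derivative G x) (at x)"
proof -
  have "((\<lambda>y. \<bar>G y - G x\<bar>) \<longlongrightarrow> 0) (at x)"
    using cont by (auto simp: isCont_def intro!: tendsto_eq_intros)
  moreover have "\<forall>\<^sub>F y in at x. norm ((h y - h x) / (y - x) - G x) \<le> \<bar>G y - G x\<bar>"
    unfolding eventually_at_topological
  proof (intro exI[of _ UNIV] conjI ballI impI)
    fix y assume "y \<noteq> x"
    \<comment> \<open>By the two bounds the linearisation error lies between \<open>0\<close> and
      \<open>(y - x) * (G y - G x)\<close>.\<close>
    have "\<bar>(h y - h x) - (y - x) * G x\<bar> \<le> \<bar>(y - x) * (G y - G x)\<bar>"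
      using lower[of y] upper[of y] by (simp add: algebra_simps)
    moreover have "(h y - h x) / (y - x) - G x = ((h y - h x) - (y - x) * G x) / (y - x)"
      using \<open>y \<noteq> x\<close> by (simp add: diff_divide_distrib)
    ultimately show "norm ((h y - h x) / (y - x) - G x) \<le> \<bar>G y - G x\<bar>"
      using \<open>y \<noteq> x\<close> by (simp add: abs_mult divide_le_eq mult.commute)
  qed auto
  ultimately have "((\<lambda>y. (h y - h x) / (y - x) - G x) \<longlongrightarrow> 0) (at x)"
    by (rule Lim_null_comparison[rotated])
  then show ?thesis
    unfolding has_field_derivative_iff by (rule LIM_zero_cancel)
qed

context prob_space
begin

text \<open>\<open>W\<close> itself need not be integrable, only its truncations are.\<close>

lemma integrable_max_const:
  fixes W :: "'a \<Rightarrow> real"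
  assumes [measurable]: "W \<in> borel_measurable M" and "integrable M (\<lambda>\<omega>. max c (W \<omega>))"
  shows "integrable M (\<lambda>\<omega>. max x (W \<omega>))"
proof -
  have "integrable M (\<lambda>\<omega>. max x (W \<omega>) - max c (W \<omega>))"
    by (rule integrable_const_bound[where B = "\<bar>x - c\<bar>"]) auto
  from Bochner_Integration.integrable_add[OF this assms(2)] show ?thesis
    by simp
qed

lemma integrable_min_const:
  fixes W :: "'a \<Rightarrow> real"
  assumes [measurable]: "W \<in> borel_measurable M" and "integrable M (\<lambda>\<omega>. min c (W \<omega>))"
  shows "integrable M (\<lambda>\<omega>. min x (W \<omega>))"
proof -
  have "integrable M (\<lambda>\<omega>. min x (W \<omega>) - min c (W \<omega>))"
    by (rule integrable_const_bound[where B = "\<bar>x - c\<bar>"]) auto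
  from Bochner_Integration.integrable_add[OF this assms(2)] show ?thesis
    by simp
qed

text \<open>For a fixed value \<open>w\<close> of \<open>W\<close>, the increment
  \<open>max y w - max x w\<close> lies between \<open>y - x\<close> times the indicator of
  \<open>w \<le> x\<close> and \<open>y - x\<close> times the indicator of \<open>w \<le> y\<close>,
  for either order of \<open>x\<close> and \<open>y\<close>. Taking expectations gives the
  hypotheses of \<open>DERIV_sandwich\<close>.\<close>

lemma DERIV_expectation_max:
  fixes W :: "'a \<Rightarrow> real"
  assumes [measurable]: "W \<in> borel_measurable M"
    and int: "\<And>x. integrable M (\<lambda>\<omega>. max x (W \<omega>))"
    and G: "\<And>x. prob {\<omega> \<in> space M. W \<omega> \<le> x} = G x"
    and cont: "isCont G x"
  shows "((\<lambda>x. \<integral>\<omega>. max x (W \<omega>) \<partial>M) has_real_derivative G x) (at x)"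
proof (rule DERIV_sandwich[OF _ _ cont])
  have ind: "integrable M (indicat_real {\<omega> \<in> space M. W \<omega> \<le> z})" for z
    by (rule integrable_real_indicator) (simp_all add: less_top[symmetric])
  \<comment> \<open>Written as an expectation, each bound can be compared pointwise in
    \<open>\<omega>\<close>.\<close>
  have eq: "(y - x) * G z = (\<integral>\<omega>. (y - x) * indicator {\<omega> \<in> space M. W \<omega> \<le> z} \<omega> \<partial>M)" for y z
    using G[of z] by simp
  fix y
  have diff: "(\<integral>\<omega>. max y (W \<omega>) \<partial>M) - (\<integral>\<omega>. max x (W \<omega>) \<partial>M)
      = (\<integral>\<omega>. max y (W \<omega>) - max x (W \<omega>) \<partial>M)"
    using int by simp
  show "(y - x) * G x \<le> (\<integral>\<omega>. max y (W \<omega>) \<partial>M) - (\<integral>\<omega>. max x (W \<omega>) \<partial>M)"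
    unfolding diff eq using int ind by (intro integral_mono) (auto split: split_indicator)
  show "(\<integral>\<omega>. max y (W \<omega>) \<partial>M) - (\<integral>\<omega>. max x (W \<omega>) \<partial>M) \<le> (y - x) * G y"
    unfolding diff eq using int ind by (intro integral_mono) (auto split: split_indicator)
qed

text \<open>The map from \<open>x\<close> to \<open>min x w\<close> is concave, so the sandwich is
  applied to the negated expectation, with slope \<open>- G\<close>.\<close>

lemma DERIV_expectation_min:
  fixes W :: "'a \<Rightarrow> real"
  assumes [measurable]: "W \<in> borel_measurable M"
    and int: "\<And>x. integrable M (\<lambda>\<omega>. min x (W \<omega>))"
    and G: "\<And>x. prob {\<omega> \<in> space M. x < W \<omega>} = G x"
    and cont: "isCont G x"
  shows "((\<lambda>x. \<integral>\<omega>. min x (W \<omega>) \<partial>M) has_real_derivative G x) (at x)"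
proof -
  have "((\<lambda>x. - (\<integral>\<omega>. min x (W \<omega>) \<partial>M)) has_real_derivative - G x) (at x)"
  proof (rule DERIV_sandwich)
    show "isCont (\<lambda>x. - G x) x"
      using cont by (intro continuous_intros)
    have ind: "integrable M (indicat_real {\<omega> \<in> space M. z < W \<omega>})" for z
      by (rule integrable_real_indicator) (simp_all add: less_top[symmetric])
    have eq: "(y - x) * - G z = - (\<integral>\<omega>. (y - x) * indicator {\<omega> \<in> space M. z < W \<omega>} \<omega> \<partial>M)" for y z
      using G[of z] by simp
    fix y
    have diff: "- (\<integral>\<omega>. min y (W \<omega>) \<partial>M) - - (\<integral>\<omega>. min x (W \<omega>) \<partial>M)
        = - (\<integral>\<omega>. min y (W \<omega>) - min x (W \<omega>) \<partial>M)"
      using int by simp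
    show "(y - x) * - G x \<le> - (\<integral>\<omega>. min y (W \<omega>) \<partial>M) - - (\<integral>\<omega>. min x (W \<omega>) \<partial>M)"
      unfolding diff eq neg_le_iff_le using int ind
      by (intro integral_mono) (auto split: split_indicator)
    show "- (\<integral>\<omega>. min y (W \<omega>) \<partial>M) - - (\<integral>\<omega>. min x (W \<omega>) \<partial>M) \<le> (y - x) * - G y"
      unfolding diff eq neg_le_iff_le using int ind
      by (intro integral_mono) (auto split: split_indicator)
  qed
  from DERIV_minus[OF this] show ?thesis
    by simp
qed

end

section \<open>Independence of extremes over disjoint blocks\<close>

text \<open>The restrictions of the family to disjoint index sets are independent, and each minimum
  is a measurable function of one restriction.\<close>

lemma (in prob_space) indep_var_Min:
  fixes X :: "'i \<Rightarrow> 'a \<Rightarrow> real"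
  assumes "indep_vars (\<lambda>_. borel) X K" "I \<inter> J = {}" "I \<subseteq> K" "J \<subseteq> K" "finite I" "finite J"
  shows "indep_var borel (\<lambda>\<omega>. MIN i\<in>I. X i \<omega>) borel (\<lambda>\<omega>. MIN j\<in>J. X j \<omega>)"
proof -
  have "indep_var borel ((\<lambda>f. Min (f ` I)) \<circ> (\<lambda>\<omega>. restrict (\<lambda>i. X i \<omega>) I))
      borel ((\<lambda>f. Min (f ` J)) \<circ> (\<lambda>\<omega>. restrict (\<lambda>i. X i \<omega>) J))"
    using assms by (intro indep_var_compose[OF indep_var_restrict] borel_measurable_Min) auto
  then show ?thesis
    by (simp add: comp_def)
qed

lemma (in prob_space) indep_var_Max:
  fixes X :: "'i \<Rightarrow> 'a \<Rightarrow> real"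
  assumes "indep_vars (\<lambda>_. borel) X K" "I \<inter> J = {}" "I \<subseteq> K" "J \<subseteq> K" "finite I" "finite J"
  shows "indep_var borel (\<lambda>\<omega>. MAX i\<in>I. X i \<omega>) borel (\<lambda>\<omega>. MAX j\<in>J. X j \<omega>)"
proof -
  have "indep_var borel ((\<lambda>f. Max (f ` I)) \<circ> (\<lambda>\<omega>. restrict (\<lambda>i. X i \<omega>) I))
      borel ((\<lambda>f. Max (f ` J)) \<circ> (\<lambda>\<omega>. restrict (\<lambda>i. X i \<omega>) J))"
    using assms by (intro indep_var_compose[OF indep_var_restrict] borel_measurable_Max) auto
  then show ?thesis
    by (simp add: comp_def)
qed

section \<open>The common distribution function on \<open>(a, b)\<close> and at its end
  points\<close>

text \<open>A strict bound on each side rules out both infinities, so \<open>real_of_ereal\<close>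
  does not return its default value here.\<close>

lemma real_of_ereal_mem_einterval:
  assumes "a < x" "x < b"
  shows "real_of_ereal x \<in> einterval a b" "ereal (real_of_ereal x) = x"
  using assms by (cases x; auto simp: einterval_iff)+

locale iid_sample =
  fixes M :: "'w measure" and X :: "nat \<Rightarrow> 'w \<Rightarrow> real"
    and F f :: "real \<Rightarrow> real" and a b :: ereal
  assumes iid: "iid_positive_density M X F f a b"
begin

sublocale prob_space M
  using iid by (simp add: iid_positive_density_def)

lemma a_less_b: "a < b"
  using iid by (simp add: iid_positive_density_def)

lemma mem_einterval_iff: "x \<in> einterval a b \<longleftrightarrow> 0 < F x \<and> F x < 1"
  using iid unfolding iid_positive_density_def by blast

lemma indep: "indep_vars (\<lambda>_. borel) X {1..}"
  using iid by (simp add: iid_positive_density_def)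

lemma density: "1 \<le> i \<Longrightarrow> distributed M lborel (X i) (\<lambda>x. ennreal (f x))"
  using iid by (simp add: iid_positive_density_def)

lemma f_pos: "x \<in> einterval a b \<Longrightarrow> 0 < f x"
  using iid by (simp add: iid_positive_density_def)

lemma measurable_X[measurable]: "1 \<le> i \<Longrightarrow> X i \<in> borel_measurable M"
  using distributed_measurable[OF density] by simp

lemma cdf_X: "1 \<le> i \<Longrightarrow> cdf (distr M borel (X i)) = F"
  using iid by (simp add: iid_positive_density_def)

lemma real_distribution_X: "1 \<le> i \<Longrightarrow> real_distribution (distr M borel (X i))"
  by (rule real_distribution_distr) simp

lemma prob_le: "1 \<le> i \<Longrightarrow> prob {\<omega> \<in> space M. X i \<omega> \<le> x} = F x"
  unfolding cdf_X[symmetric] cdf_def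
  by (subst measure_distr) (auto intro!: arg_cong[where f = prob])

lemma prob_greater: "1 \<le> i \<Longrightarrow> prob {\<omega> \<in> space M. x < X i \<omega>} = 1 - F x"
  using prob_neg[of "\<lambda>\<omega>. X i \<omega> \<le> x"] by (simp add: prob_le not_le)

lemma F_mono: "x \<le> y \<Longrightarrow> F x \<le> F y"
  using finite_borel_measure.cdf_nondecreasing[OF
      real_distribution.finite_borel_measure_M[OF real_distribution_X[OF order_refl]]]
  by (simp add: cdf_X)

lemma F_nonneg: "0 \<le> F x"
  using prob_le[of 1 x] measure_nonneg by (metis order_refl)

lemma F_le_1: "F x \<le> 1"
  using prob_le[of 1 x] prob_le_1 by (metis order_refl)

text \<open>A law with a density has no atoms, since a single point is Lebesgue null.\<close>

lemma isCont_F: "isCont F x"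
proof -
  interpret D: real_distribution "distr M borel (X 1)"
    by (rule real_distribution_X) simp
  have "AE y in lborel. ennreal (f y) * indicator {x} y = 0"
    using AE_lborel_singleton[of x] by eventually_elim simp
  then have "(\<integral>\<^sup>+y. ennreal (f y) * indicator {x} y \<partial>lborel) = (\<integral>\<^sup>+y. 0 \<partial>(lborel :: real measure))"
    by (rule nn_integral_cong_AE)
  moreover have "emeasure M (X 1 -` {x} \<inter> space M) = (\<integral>\<^sup>+y. ennreal (f y) * indicator {x} y \<partial>lborel)"
    by (rule distributed_emeasure[OF density]) auto
  ultimately have "measure (distr M borel (X 1)) {x} = 0"
    by (simp add: emeasure_distr measure_def)
  then show ?thesis
    using D.isCont_cdf[of x] by (simp add: cdf_X)
qed

text \<open>If the probability were zero, the density would vanish almost everywhere on the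
  interval; being positive there, it would force an interval of positive length to be Lebesgue
  null.\<close>

lemma prob_Ioo_pos:
  assumes "1 \<le> i" "c < d" "{c<..<d} \<subseteq> einterval a b"
  shows "0 < prob {\<omega> \<in> space M. X i \<omega> \<in> {c<..<d}}"
proof (rule ccontr)
  have [measurable]: "(\<lambda>x. ennreal (f x)) \<in> borel_measurable lborel"
    using distributed_borel_measurable[OF density[OF assms(1)]] .
  assume "\<not> ?thesis"
  then have "prob {\<omega> \<in> space M. X i \<omega> \<in> {c<..<d}} = 0"
    using measure_nonneg[of M] by (simp add: not_less order_antisym)
  moreover have "{\<omega> \<in> space M. X i \<omega> \<in> {c<..<d}} = X i -` {c<..<d} \<inter> space M"
    by auto
  ultimately have "emeasure M (X i -` {c<..<d} \<inter> space M) = 0"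
    by (simp add: emeasure_eq_measure)
  then have "(\<integral>\<^sup>+y. ennreal (f y) * indicator {c<..<d} y \<partial>lborel) = 0"
    using distributed_emeasure[OF density[OF assms(1)], of "{c<..<d}"] by simp
  then have "AE y in lborel. ennreal (f y) * indicator {c<..<d} y = 0"
    by (subst (asm) nn_integral_0_iff_AE) auto
  then have "AE y in lborel. y \<notin> {c<..<d}"
  proof eventually_elim
    case (elim y)
    then show ?case
      using f_pos[of y] assms(3) by (auto split: split_indicator_asm simp: ennreal_eq_0_iff)
  qed
  then have "{c<..<d} \<in> null_sets lborel"
    by (subst AE_iff_null_sets) auto
  then show False
    using assms(2) by (auto simp: null_sets_def)
qed

lemma F_less:
  assumes "x \<in> einterval a b" "y \<in> einterval a b" "x < y"
  shows "F x < F y"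
proof -
  interpret D: real_distribution "distr M borel (X 1)"
    by (rule real_distribution_X) simp
  have "{x<..<y} \<subseteq> einterval a b"
    using assms by (auto simp: einterval_iff) (meson ereal_less_eq(3) le_less_trans less_le_trans less_imp_le)+
  then have "0 < prob {\<omega> \<in> space M. X 1 \<omega> \<in> {x<..<y}}"
    using prob_Ioo_pos[of 1 x y] assms by simp
  \<comment> \<open>The open interval is enlarged to the half-open one, whose mass is exactly the
    increment of \<open>F\<close>.\<close>
  also have "\<dots> \<le> prob (X 1 -` {x<..y} \<inter> space M)"
    by (rule finite_measure_mono) auto
  also have "\<dots> = F y - F x"
    using D.cdf_diff_eq[OF assms(3)] by (simp add: cdf_X measure_distr)
  finally show ?thesis
    by simp
qed

lemma F_onto:
  assumes "0 < p" "p < 1"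
  shows "\<exists>x. F x = p"
proof -
  interpret D: real_distribution "distr M borel (X 1)"
    by (rule real_distribution_X) simp
  have "(F \<longlongrightarrow> 0) at_bot" "(F \<longlongrightarrow> 1) at_top"
    using D.cdf_lim_at_bot D.cdf_lim_at_top_prob by (simp_all add: cdf_X)
  then have "\<forall>\<^sub>F x in at_bot. F x < p" "\<forall>\<^sub>F x in at_top. p < F x"
    using assms by (auto dest: order_tendstoD)
  then obtain l u where lu: "F l < p" "p < F u"
    by (meson eventually_at_bot_linorder eventually_at_top_linorder order_refl)
  then have "l \<le> u"
    using F_mono[of u l] by linarith
  then show ?thesis
    using IVT[of F l p u] lu isCont_F by auto
qed

text \<open>Outside the interval \<open>F\<close> is \<open>0\<close> or \<open>1\<close>;
  monotonicity against an interior point \<open>c\<close> to the right excludes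
  \<open>1\<close>.\<close>

lemma F_eq_0:
  assumes "ereal x \<le> a"
  shows "F x = 0"
proof -
  obtain c where c: "c \<in> einterval a b"
    using einterval_nonempty[OF a_less_b] by auto
  then have "x \<le> c"
    using assms by (metis einterval_iff ereal_less_eq(3) less_imp_le order_trans)
  then have "F x < 1"
    using F_mono[of x c] c by (auto simp: mem_einterval_iff)
  moreover have "x \<notin> einterval a b"
    using assms by (auto simp: einterval_iff)
  ultimately show ?thesis
    using F_nonneg[of x] by (auto simp: mem_einterval_iff)
qed

lemma F_eq_1:
  assumes "b \<le> ereal x"
  shows "F x = 1"
proof -
  obtain c where c: "c \<in> einterval a b"
    using einterval_nonempty[OF a_less_b] by auto
  then have "c \<le> x"
    using assms by (metis einterval_iff ereal_less_eq(3) less_imp_le order_trans)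
  then have "0 < F x"
    using F_mono[of c x] c by (auto simp: mem_einterval_iff)
  moreover have "x \<notin> einterval a b"
    using assms by (auto simp: einterval_iff)
  ultimately show ?thesis
    using F_le_1[of x] by (auto simp: mem_einterval_iff)
qed

text \<open>Every extended real strictly between \<open>a\<close> and \<open>b\<close> is a real
  point of the interval, so a property of those points holds near \<open>a\<close>, whether
  \<open>a\<close> is finite or not.\<close>

lemma eventually_at_right_a:
  assumes "\<And>x. x \<in> einterval a b \<Longrightarrow> P (ereal x)"
  shows "\<forall>\<^sub>F x in at_right a. P x"
  unfolding eventually_at_right[OF a_less_b]
  using a_less_b assms real_of_ereal_mem_einterval by metis

lemma eventually_at_left_b:
  assumes "\<And>x. x \<in> einterval a b \<Longrightarrow> P (ereal x)"
  shows "\<forall>\<^sub>F x in at_left b. P x"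
  unfolding eventually_at_left[OF a_less_b]
  using a_less_b assms real_of_ereal_mem_einterval by metis

lemma F_tendsto_0: "((\<lambda>x. F (real_of_ereal x)) \<longlongrightarrow> 0) (at_right a)"
proof (rule order_tendstoI)
  fix e :: real
  assume "0 < e"
  \<comment> \<open>Capping \<open>e\<close> at \<open>1\<close> keeps the level strictly between
    \<open>0\<close> and \<open>1\<close>. Hence it is attained, and attained inside
    \<open>(a, b)\<close>; monotonicity then controls all points between \<open>a\<close> and
    \<open>y\<close>.\<close>
  then obtain y where y: "F y = min e 1 / 2"
    using F_onto[of "min e 1 / 2"] by fastforce
  with \<open>0 < e\<close> have yab: "y \<in> einterval a b"
    by (auto simp: mem_einterval_iff)
  show "\<forall>\<^sub>F x in at_right a. F (real_of_ereal x) < e"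
    unfolding eventually_at_right[OF a_less_b]
  proof (intro exI[of _ "ereal y"] conjI allI impI)
    show "a < ereal y"
      using yab by (simp add: einterval_iff)
    fix x assume "a < x" "x < ereal y"
    then have "F (real_of_ereal x) \<le> F y"
      by (intro F_mono) (cases x; auto)
    then show "F (real_of_ereal x) < e"
      using y \<open>0 < e\<close> by (auto simp: min_def split: if_splits)
  qed
next
  fix e :: real
  assume "e < 0"
  then show "\<forall>\<^sub>F x in at_right a. e < F (real_of_ereal x)"
    using F_nonneg less_le_trans by (intro always_eventually) blast
qed

lemma F_tendsto_1: "((\<lambda>x. F (real_of_ereal x)) \<longlongrightarrow> 1) (at_left b)"
proof (rule order_tendstoI)
  fix e :: real
  assume "e < 1"
  then obtain y where y: "F y = (max e 0 + 1) / 2"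
    using F_onto[of "(max e 0 + 1) / 2"] by fastforce
  with \<open>e < 1\<close> have yab: "y \<in> einterval a b"
    by (auto simp: mem_einterval_iff)
  show "\<forall>\<^sub>F x in at_left b. e < F (real_of_ereal x)"
    unfolding eventually_at_left[OF a_less_b]
  proof (intro exI[of _ "ereal y"] conjI allI impI)
    show "ereal y < b"
      using yab by (simp add: einterval_iff)
    fix x assume "ereal y < x" "x < b"
    then have "F y \<le> F (real_of_ereal x)"
      by (intro F_mono) (cases x; auto)
    then show "e < F (real_of_ereal x)"
      using y \<open>e < 1\<close> by (auto simp: max_def split: if_splits)
  qed
next
  fix e :: real
  assume "1 < e"
  then show "\<forall>\<^sub>F x in at_left b. F (real_of_ereal x) < e"
    using F_le_1 le_less_trans by (intro always_eventually) blast
qed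

section \<open>Laws of the maximum and minimum of a block\<close>

lemma prob_all:
  assumes "J \<noteq> {}" "finite J" "J \<subseteq> {1..}" "A \<in> sets borel"
  shows "prob {\<omega> \<in> space M. \<forall>j\<in>J. X j \<omega> \<in> A} = (\<Prod>j\<in>J. prob {\<omega> \<in> space M. X j \<omega> \<in> A})"
proof -
  have "{\<omega> \<in> space M. \<forall>j\<in>J. X j \<omega> \<in> A} = (\<Inter>j\<in>J. X j -` A \<inter> space M)"
    using assms by auto
  moreover have "{\<omega> \<in> space M. X j \<omega> \<in> A} = X j -` A \<inter> space M" for j
    by auto
  ultimately show ?thesis
    using indep_varsD[OF indep assms(1-3), of "\<lambda>_. A"] assms by simp
qed

text \<open>A maximum is at most \<open>x\<close> exactly when all observations are, so independence
  gives a product. For a minimum the event that factorises is the upper tail.\<close>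

lemma prob_Max_le:
  assumes "J \<noteq> {}" "finite J" "J \<subseteq> {1..}"
  shows "prob {\<omega> \<in> space M. (MAX j\<in>J. X j \<omega>) \<le> x} = F x ^ card J"
proof -
  have "prob {\<omega> \<in> space M. (MAX j\<in>J. X j \<omega>) \<le> x} = prob {\<omega> \<in> space M. \<forall>j\<in>J. X j \<omega> \<in> {..x}}"
    using assms by simp
  also have "\<dots> = (\<Prod>j\<in>J. prob {\<omega> \<in> space M. X j \<omega> \<in> {..x}})"
    using assms by (intro prob_all) auto
  also have "\<dots> = (\<Prod>j\<in>J. F x)"
    using assms by (intro prod.cong) (auto simp: prob_le)
  finally show ?thesis
    by simp
qed

lemma prob_Min_greater:
  assumes "J \<noteq> {}" "finite J" "J \<subseteq> {1..}"
  shows "prob {\<omega> \<in> space M. x < (MIN j\<in>J. X j \<omega>)} = (1 - F x) ^ card J"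
proof -
  have "prob {\<omega> \<in> space M. x < (MIN j\<in>J. X j \<omega>)} = prob {\<omega> \<in> space M. \<forall>j\<in>J. X j \<omega> \<in> {x<..}}"
    using assms by simp
  also have "\<dots> = (\<Prod>j\<in>J. prob {\<omega> \<in> space M. X j \<omega> \<in> {x<..}})"
    using assms by (intro prob_all) auto
  also have "\<dots> = (\<Prod>j\<in>J. 1 - F x)"
    using assms by (intro prod.cong) (auto simp: prob_greater)
  finally show ?thesis
    by simp
qed

section \<open>Identifying \<open>g\<close> on all of \<open>(a, b)\<close>\<close>

text \<open>If \<open>g\<close> and \<open>h\<close> differed at \<open>x\<close>, by continuity
  they would differ on a small interval around \<open>x\<close>. With positive probability all
  observations in \<open>J\<close> fall into it, and then so does \<open>Z\<close>. The assumption
  on \<open>Z\<close> is satisfied by minima and maxima alike.\<close>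

lemma continuous_AE_unique:
  assumes cont: "continuous_on (einterval a b) g" "continuous_on (einterval a b) h"
    and AE: "AE \<omega> in M. g (Z \<omega>) = h (Z \<omega>)"
    and J: "J \<noteq> {}" "finite J" "J \<subseteq> {1..}"
    and Z: "\<And>\<omega> c d. (\<forall>j\<in>J. X j \<omega> \<in> {c<..<d}) \<Longrightarrow> Z \<omega> \<in> {c<..<d}"
    and x: "x \<in> einterval a b"
  shows "g x = (h x :: real)"
proof (rule ccontr)
  assume neq: "g x \<noteq> h x"
  have "open (einterval a b \<inter> (\<lambda>y. g y - h y) -` (- {0}))"
    using cont by (intro continuous_open_preimage continuous_intros) auto
  then obtain e where e: "0 < e" "ball x e \<subseteq> einterval a b \<inter> (\<lambda>y. g y - h y) -` (- {0})"
    using x neq by (auto elim!: openE)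
  define I where "I = {x - e<..<x + e}"
  have I: "I \<subseteq> einterval a b" "\<And>y. y \<in> I \<Longrightarrow> g y \<noteq> h y"
    using e(2) by (auto simp: I_def ball_eq_greaterThanLessThan)
  let ?E = "{\<omega> \<in> space M. \<forall>j\<in>J. X j \<omega> \<in> I}"
  have "prob ?E = (\<Prod>j\<in>J. prob {\<omega> \<in> space M. X j \<omega> \<in> I})"
    using J by (intro prob_all) (auto simp: I_def)
  also have "\<dots> > 0"
    using J I(1) e(1) unfolding I_def by (intro prod_pos prob_Ioo_pos) auto
  finally have pos: "0 < prob ?E" .
  \<comment> \<open>A set that is not an event has measure \<open>0\<close> by convention, so
    positive measure already gives measurability.\<close>
  have "?E \<in> events"
    using pos measure_notin_sets by fastforce
  moreover have "AE \<omega> in M. \<omega> \<notin> ?E"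
    using AE
  proof eventually_elim
    case (elim \<omega>)
    then show ?case
      using Z[of \<omega> "x - e" "x + e"] I(2)[of "Z \<omega>"] by (auto simp: I_def)
  qed
  ultimately have "prob ?E = 0"
    by (simp add: prob_eq_0)
  with pos show False
    by simp
qed

text \<open>The derivative is local and the interval is open, so values of \<open>g\<close> outside
  \<open>(a, b)\<close> do not matter.\<close>

lemma deriv_eqI:
  assumes "\<And>y. y \<in> einterval a b \<Longrightarrow> g y = h y"
    and "(h has_real_derivative D) (at x)" "x \<in> einterval a b"
  shows "deriv g x = D"
  by (rule DERIV_imp_deriv, rule has_field_derivative_transform_within_open[OF assms(2) open_einterval assms(3)])
    (use assms(1) in simp)

section \<open>The regressions of the minimum and of the maximum\<close>

lemma regression_min:
  assumes m: "1 \<le> m" "m < n" and g: "g differentiable_on einterval a b"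
    and int: "integrable M (order_statistic X 1 n)"
    and reg: "AE \<omega> in M. cond_exp_given M (order_statistic X 1 n) (order_statistic X 1 m) \<omega>
                    = g (order_statistic X 1 m \<omega>)"
  shows "((\<lambda>x. ereal (g (real_of_ereal x))) \<longlongrightarrow> a) (at_right a)"
    and "\<And>x. x \<in> einterval a b \<Longrightarrow> deriv g x = (1 - F x) ^ (n - m)"
proof -
  define Z where "Z \<omega> = (MIN j\<in>{1..m}. X j \<omega>)" for \<omega>
  define W where "W \<omega> = (MIN j\<in>{Suc m..n}. X j \<omega>)" for \<omega>
  define h where "h x = (\<integral>\<omega>. min x (W \<omega>) \<partial>M)" for x
  have Zm: "order_statistic X 1 m = Z"
    using m by (auto simp: Z_def order_statistic_first simp del: One_nat_def)
  have Zn: "order_statistic X 1 n = (\<lambda>\<omega>. min (Z \<omega>) (W \<omega>))"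
    using order_statistic_first_split[OF m, of X]
    by (simp add: fun_eq_iff Zm[symmetric] W_def del: One_nat_def)
  have ind: "indep_var borel Z borel W"
    unfolding Z_def W_def using indep by (rule indep_var_Min) auto
  have [measurable]: "Z \<in> borel_measurable M" "W \<in> borel_measurable M"
    using ind unfolding indep_var_distribution_eq by auto
  let ?\<phi> = "\<lambda>x::real \<times> real. min (fst x) (snd x)"
  have \<phi>: "?\<phi> \<in> borel_measurable (borel \<Otimes>\<^sub>M borel)"
    by measurable
  have int_pair: "integrable M (\<lambda>\<omega>. ?\<phi> (Z \<omega>, W \<omega>))"
    using int by (simp add: Zn del: One_nat_def)
  \<comment> \<open>One integrable truncation suffices: truncations at two levels differ by a
    bounded function.\<close>
  obtain c where "integrable M (\<lambda>\<omega>. min c (W \<omega>))"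
    using indep_var_ex_integrable_section[OF ind \<phi> int_pair] by auto
  then have intW: "integrable M (\<lambda>\<omega>. min x (W \<omega>))" for x
    by (rule integrable_min_const[rotated]) measurable
  have W: "prob {\<omega> \<in> space M. x < W \<omega>} = (1 - F x) ^ (n - m)" for x
    using prob_Min_greater[of "{Suc m..n}" x] m by (simp add: W_def Suc_le_eq)
  have h: "(h has_real_derivative (1 - F x) ^ (n - m)) (at x)" for x
    unfolding h_def
    by (rule DERIV_expectation_min[OF _ intW W]) (auto intro!: continuous_intros isCont_F)
  have Z_Ioo: "Z \<omega> \<in> {c<..<d}" if "\<forall>j\<in>{1..m}. X j \<omega> \<in> {c<..<d}" for \<omega> c d
  proof -
    have "Z \<omega> \<in> (\<lambda>j. X j \<omega>) ` {1..m}"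
      unfolding Z_def using m by (intro Min_in) auto
    then show ?thesis
      using that by auto
  qed
  \<comment> \<open>Both sides are almost surely equal to the conditional expectation, one by the
    regression assumption and the other by the freezing rule.\<close>
  have "AE \<omega> in M. g (Z \<omega>) = h (Z \<omega>)"
    using reg cond_exp_given_indep_var[OF ind \<phi> int_pair]
    unfolding Zm Zn by eventually_elim (simp add: h_def)
  moreover have "continuous_on (einterval a b) h"
    using h DERIV_isCont by (intro continuous_at_imp_continuous_on) blast
  ultimately have gh: "g x = h x" if "x \<in> einterval a b" for x
    using that m Z_Ioo differentiable_imp_continuous_on[OF g]
    by (intro continuous_AE_unique[where Z = Z and J = "{1..m}" and x = x and g = g and h = h]) auto
  show "deriv g x = (1 - F x) ^ (n - m)" if "x \<in> einterval a b" for x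
    using gh h that by (rule deriv_eqI)
  have upper: "h x \<le> x" for x
    unfolding h_def by (rule integral_le_const[OF intW]) auto
  \<comment> \<open>Only a finite \<open>a\<close> needs an argument: \<open>F\<close> vanishes
    there, so \<open>W\<close> exceeds \<open>a\<close> almost surely. The value minus infinity is
    trivial, and plus infinity contradicts \<open>a < b\<close>.\<close>
  have lower: "a \<le> ereal (h x)" if "x \<in> einterval a b" for x
  proof (cases a)
    case (real r)
    have "F r = 0"
      by (rule F_eq_0) (simp add: real)
    then have "prob {\<omega> \<in> space M. r < W \<omega>} = 1"
      by (simp add: W)
    then have "AE \<omega> in M. r < W \<omega>"
      by (subst (asm) prob_Collect_eq_1) auto
    then have "AE \<omega> in M. r \<le> min x (W \<omega>)"
      by eventually_elim (use that real in \<open>auto simp: einterval_iff\<close>)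
    then have "r \<le> h x"
      unfolding h_def by (rule integral_ge_const[OF intW])
    then show ?thesis
      by (simp add: real)
  qed (use a_less_b in auto)
  show "((\<lambda>x. ereal (g (real_of_ereal x))) \<longlongrightarrow> a) (at_right a)"
  \<comment> \<open>The squeeze is between the constant \<open>a\<close> and the identity, in the
    extended reals, so an infinite \<open>a\<close> needs no separate case.\<close>
  proof (rule tendsto_sandwich)
    show "\<forall>\<^sub>F x in at_right a. a \<le> ereal (g (real_of_ereal x))"
      by (rule eventually_at_right_a) (simp add: gh lower)
    show "\<forall>\<^sub>F x in at_right a. ereal (g (real_of_ereal x)) \<le> x"
      by (rule eventually_at_right_a) (simp add: gh upper)
  qed (auto intro: tendsto_ident_at)
qed

lemma regression_max:
  assumes m: "1 \<le> m" "m < n" and g: "g differentiable_on einterval a b"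
    and int: "integrable M (order_statistic X n n)"
    and reg: "AE \<omega> in M. cond_exp_given M (order_statistic X n n) (order_statistic X m m) \<omega>
                    = g (order_statistic X m m \<omega>)"
  shows "((\<lambda>x. ereal (g (real_of_ereal x))) \<longlongrightarrow> b) (at_left b)"
    and "\<And>x. x \<in> einterval a b \<Longrightarrow> deriv g x = F x ^ (n - m)"
proof -
  define Z where "Z \<omega> = (MAX j\<in>{1..m}. X j \<omega>)" for \<omega>
  define W where "W \<omega> = (MAX j\<in>{Suc m..n}. X j \<omega>)" for \<omega>
  define h where "h x = (\<integral>\<omega>. max x (W \<omega>) \<partial>M)" for x
  have Zm: "order_statistic X m m = Z"
    using m by (auto simp: Z_def order_statistic_last simp del: One_nat_def)
  have Zn: "order_statistic X n n = (\<lambda>\<omega>. max (Z \<omega>) (W \<omega>))"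
    using order_statistic_last_split[OF m, of X]
    by (simp add: fun_eq_iff Zm[symmetric] W_def del: One_nat_def)
  have ind: "indep_var borel Z borel W"
    unfolding Z_def W_def using indep by (rule indep_var_Max) auto
  have [measurable]: "Z \<in> borel_measurable M" "W \<in> borel_measurable M"
    using ind unfolding indep_var_distribution_eq by auto
  let ?\<phi> = "\<lambda>x::real \<times> real. max (fst x) (snd x)"
  have \<phi>: "?\<phi> \<in> borel_measurable (borel \<Otimes>\<^sub>M borel)"
    by measurable
  have int_pair: "integrable M (\<lambda>\<omega>. ?\<phi> (Z \<omega>, W \<omega>))"
    using int by (simp add: Zn del: One_nat_def)
  obtain c where "integrable M (\<lambda>\<omega>. max c (W \<omega>))"
    using indep_var_ex_integrable_section[OF ind \<phi> int_pair] by auto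
  then have intW: "integrable M (\<lambda>\<omega>. max x (W \<omega>))" for x
    by (rule integrable_max_const[rotated]) measurable
  have W: "prob {\<omega> \<in> space M. W \<omega> \<le> x} = F x ^ (n - m)" for x
    using prob_Max_le[of "{Suc m..n}" x] m by (simp add: W_def Suc_le_eq)
  have h: "(h has_real_derivative F x ^ (n - m)) (at x)" for x
    unfolding h_def
    by (rule DERIV_expectation_max[OF _ intW W]) (auto intro!: continuous_intros isCont_F)
  have Z_Ioo: "Z \<omega> \<in> {c<..<d}" if "\<forall>j\<in>{1..m}. X j \<omega> \<in> {c<..<d}" for \<omega> c d
  proof -
    have "Z \<omega> \<in> (\<lambda>j. X j \<omega>) ` {1..m}"
      unfolding Z_def using m by (intro Max_in) auto
    then show ?thesis
      using that by auto
  qed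
  have "AE \<omega> in M. g (Z \<omega>) = h (Z \<omega>)"
    using reg cond_exp_given_indep_var[OF ind \<phi> int_pair]
    unfolding Zm Zn by eventually_elim (simp add: h_def)
  moreover have "continuous_on (einterval a b) h"
    using h DERIV_isCont by (intro continuous_at_imp_continuous_on) blast
  ultimately have gh: "g x = h x" if "x \<in> einterval a b" for x
    using that m Z_Ioo differentiable_imp_continuous_on[OF g]
    by (intro continuous_AE_unique[where Z = Z and J = "{1..m}" and x = x and g = g and h = h]) auto
  show "deriv g x = F x ^ (n - m)" if "x \<in> einterval a b" for x
    using gh h that by (rule deriv_eqI)
  have lower: "x \<le> h x" for x
    unfolding h_def by (rule integral_ge_const[OF intW]) auto
  \<comment> \<open>For a finite \<open>b\<close>, \<open>F b = 1\<close> bounds \<open>W\<close> by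
    \<open>b\<close> almost surely; the truncation point \<open>x\<close> lies below
    \<open>b\<close> as well.\<close>
  have upper: "ereal (h x) \<le> b" if "x \<in> einterval a b" for x
  proof (cases b)
    case (real r)
    have "F r = 1"
      by (rule F_eq_1) (simp add: real)
    then have "prob {\<omega> \<in> space M. W \<omega> \<le> r} = 1"
      by (simp add: W)
    then have "AE \<omega> in M. W \<omega> \<le> r"
      by (subst (asm) prob_Collect_eq_1) auto
    then have "AE \<omega> in M. max x (W \<omega>) \<le> r"
      by eventually_elim (use that real in \<open>auto simp: einterval_iff\<close>)
    then have "h x \<le> r"
      unfolding h_def by (rule integral_le_const[OF intW])
    then show ?thesis
      by (simp add: real)
  qed (use a_less_b in auto)
  show "((\<lambda>x. ereal (g (real_of_ereal x))) \<longlongrightarrow> b) (at_left b)"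
  proof (rule tendsto_sandwich)
    show "\<forall>\<^sub>F x in at_left b. x \<le> ereal (g (real_of_ereal x))"
      by (rule eventually_at_left_b) (simp add: gh lower)
    show "\<forall>\<^sub>F x in at_left b. ereal (g (real_of_ereal x)) \<le> b"
      by (rule eventually_at_left_b) (simp add: gh upper)
  qed (auto intro: tendsto_ident_at)
qed

end

text \<open>Limits are taken along one-sided filters at extended-real end points, which treats
  finite and infinite \<open>a\<close>, \<open>b\<close> uniformly. Monotonicity of the derivative
  is stated in its strict form.\<close>

theorem theorem3p8:
  fixes M :: "'w measure" and X :: "nat \<Rightarrow> 'w \<Rightarrow> real"
    and F f g :: "real \<Rightarrow> real" and a b :: ereal and m n :: nat
  assumes "iid_positive_density M X F f a b"
    and "1 \<le> m" and "m < n"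
    and "g differentiable_on einterval a b"
  shows
    "(integrable M (order_statistic X 1 n) \<and>
      (AE \<omega> in M. cond_exp_given M (order_statistic X 1 n) (order_statistic X 1 m) \<omega>
                    = g (order_statistic X 1 m \<omega>))
      \<longrightarrow>
        (((\<lambda>x. ereal (g (real_of_ereal x))) \<longlongrightarrow> a) (at_right a)) \<and>
        (strict_antimono_on (einterval a b) (deriv g) \<and>
         ((\<lambda>x. deriv g (real_of_ereal x)) \<longlongrightarrow> 1) (at_right a) \<and>
         ((\<lambda>x. deriv g (real_of_ereal x)) \<longlongrightarrow> 0) (at_left b)) \<and>
        (\<forall>x \<in> einterval a b. F x = 1 - root (n - m) (deriv g x)))
     \<and>
     (integrable M (order_statistic X n n) \<and>
      (AE \<omega> in M. cond_exp_given M (order_statistic X n n) (order_statistic X m m) \<omega>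
                    = g (order_statistic X m m \<omega>))
      \<longrightarrow>
        (((\<lambda>x. ereal (g (real_of_ereal x))) \<longlongrightarrow> b) (at_left b)) \<and>
        (strict_mono_on (einterval a b) (deriv g) \<and>
         ((\<lambda>x. deriv g (real_of_ereal x)) \<longlongrightarrow> 0) (at_right a) \<and>
         ((\<lambda>x. deriv g (real_of_ereal x)) \<longlongrightarrow> 1) (at_left b)) \<and>
        (\<forall>x \<in> einterval a b. F x = root (n - m) (deriv g x)))"
proof -
  interpret iid_sample M X F f a b
    by standard fact
  have k: "0 < n - m"
    using assms by simp
  show ?thesis
  proof (intro conjI impI; elim conjE)
    assume "integrable M (order_statistic X 1 n)"
      and "AE \<omega> in M. cond_exp_given M (order_statistic X 1 n) (order_statistic X 1 m) \<omega>
                    = g (order_statistic X 1 m \<omega>)"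
    note reg = regression_min[OF assms(2-4) this]
    show "((\<lambda>x. ereal (g (real_of_ereal x))) \<longlongrightarrow> a) (at_right a)"
      by (rule reg(1))
    \<comment> \<open>Strictness comes from \<open>F_less\<close>, the positive exponent, and
      \<open>F \<le> 1\<close>, which keeps the base \<open>1 - F\<close> nonnegative.\<close>
    show "strict_antimono_on (einterval a b) (deriv g)"
      using F_less k F_le_1 by (intro monotone_onI) (simp add: reg(2) power_strict_mono)
    have "((\<lambda>x. (1 - F (real_of_ereal x)) ^ (n - m)) \<longlongrightarrow> (1 - 0) ^ (n - m)) (at_right a)"
      by (intro tendsto_intros F_tendsto_0)
    moreover have "\<forall>\<^sub>F x in at_right a. (1 - F (real_of_ereal x)) ^ (n - m) = deriv g (real_of_ereal x)"
      by (rule eventually_at_right_a) (simp add: reg(2))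
    ultimately show "((\<lambda>x. deriv g (real_of_ereal x)) \<longlongrightarrow> 1) (at_right a)"
      using Lim_transform_eventually by fastforce
    have "((\<lambda>x. (1 - F (real_of_ereal x)) ^ (n - m)) \<longlongrightarrow> (1 - 1) ^ (n - m)) (at_left b)"
      by (intro tendsto_intros F_tendsto_1)
    moreover have "\<forall>\<^sub>F x in at_left b. (1 - F (real_of_ereal x)) ^ (n - m) = deriv g (real_of_ereal x)"
      by (rule eventually_at_left_b) (simp add: reg(2))
    \<comment> \<open>The exponent \<open>n - m\<close> must be positive here, since
      \<open>0 ^ 0\<close> is \<open>1\<close>.\<close>
    ultimately show "((\<lambda>x. deriv g (real_of_ereal x)) \<longlongrightarrow> 0) (at_left b)"
      using Lim_transform_eventually k by (fastforce simp: zero_power)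
    show "\<forall>x\<in>einterval a b. F x = 1 - root (n - m) (deriv g x)"
      using k F_le_1 by (simp add: reg(2) real_root_power_cancel)
  next
    assume "integrable M (order_statistic X n n)"
      and "AE \<omega> in M. cond_exp_given M (order_statistic X n n) (order_statistic X m m) \<omega>
                    = g (order_statistic X m m \<omega>)"
    note reg = regression_max[OF assms(2-4) this]
    show "((\<lambda>x. ereal (g (real_of_ereal x))) \<longlongrightarrow> b) (at_left b)"
      by (rule reg(1))
    show "strict_mono_on (einterval a b) (deriv g)"
      using F_less k F_nonneg by (intro strict_mono_onI) (simp add: reg(2) power_strict_mono)
    have "((\<lambda>x. F (real_of_ereal x) ^ (n - m)) \<longlongrightarrow> 0 ^ (n - m)) (at_right a)"
      by (intro tendsto_intros F_tendsto_0)
    moreover have "\<forall>\<^sub>F x in at_right a. F (real_of_ereal x) ^ (n - m) = deriv g (real_of_ereal x)"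
      by (rule eventually_at_right_a) (simp add: reg(2))
    ultimately show "((\<lambda>x. deriv g (real_of_ereal x)) \<longlongrightarrow> 0) (at_right a)"
      using Lim_transform_eventually k by (fastforce simp: zero_power)
    have "((\<lambda>x. F (real_of_ereal x) ^ (n - m)) \<longlongrightarrow> 1 ^ (n - m)) (at_left b)"
      by (intro tendsto_intros F_tendsto_1)
    moreover have "\<forall>\<^sub>F x in at_left b. F (real_of_ereal x) ^ (n - m) = deriv g (real_of_ereal x)"
      by (rule eventually_at_left_b) (simp add: reg(2))
    ultimately show "((\<lambda>x. deriv g (real_of_ereal x)) \<longlongrightarrow> 1) (at_left b)"
      using Lim_transform_eventually by fastforce
    \<comment> \<open>The root undoes the power because \<open>F\<close> is nonnegative and the
      exponent positive.\<close>
    show "\<forall>x\<in>einterval a b. F x = root (n - m) (deriv g x)"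
      using k F_nonneg by (simp add: reg(2) real_root_power_cancel)
  qed
qed

end
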